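(* (Strong Parity Theorem.) Let $\mathcal U\in\mathcal L(\mathcal A_{\mathsf P})$ be a subspace whose defining move equations involve $\kappa$ pieces, and suppose the quasipolynomial $\alpha(\mathcal U;n)$ has period $p$. Then the number of values of $\alpha(\mathcal U;n)$ that are sufficient to determine all the coefficients in all constituents of $\alpha(\mathcal U;n)$ is $\lceil p(\kappa-\tfrac12\operatorname{codim}\mathcal U)\rceil+\epsilon$, where $\epsilon=1$ if $\operatorname{codim}\mathcal U$ is even and $\epsilon=0$ if it is odd.
   Context: A rider piece $\mathsf P$ has a finite set $\mathcal M$ of basic moves: nonzero integer vectors $m=(c,d)$ with $\gcd(c,d)=1$, no two parallel. For $q$ pieces, configurations are points $(z_1,\dots,z_q)\in\mathbb R^{2q}$, $z_i=(x_i,y_i)$. The move arrangement $\mathcal A_{\mathsf P}$ consists of the hyperplanes $\mathcal H^{d/c}_{ij}=\{(z_1,\dots,z_q):(z_j-z_i)\cdot(d,-c)=0\}$ for $i<j$ and $(c,d)\in\mathcal M$; $\mathcal L(\mathcal A_{\mathsf P})$ is the set of intersections of subsets of these hyperplanes. For $\mathcal U\in\mathcal L(\mathcal A_{\mathsf P})$ involving a set of $\kappa$ pieces, its essential part $\tilde{\mathcal U}\subseteq\mathbb R^{2\kappa}$ is the subspace defined by the same move equations in the coordinates of those $\kappa$ pieces, and $\alpha(\mathcal U;n)$ is the number of integral points in $(n+1)\cdot\big((0,1)^{2\kappa}\cap\tilde{\mathcal U}\big)$. It is known (Ehrhart theory) that $\alpha(\mathcal U;n)$ is a quasipolynomial in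 $n$ of degree $d=2\kappa-\operatorname{codim}\mathcal U$ whose leading coefficient is the same known constant for all constituents, and (parity/reciprocity) that its constituents $\alpha_0,\dots,\alpha_{p-1}$ (with $\alpha(n)=\alpha_{n\bmod p}(n)$, indices mod $p$) satisfy $\alpha_{-i}(-n)=(-1)^d\alpha_i(n)$. *)

theory Defs
  imports "HOL-Analysis.Analysis" "HOL-Computational_Algebra.Polynomial"
begin

definition rider_moves :: "(int \<times> int) set \<Rightarrow> bool" where
  "rider_moves M \<longleftrightarrow> finite M \<and>
     (\<forall>(c,d)\<in>M. (c,d) \<noteq> (0,0) \<and> gcd c d = 1) \<and>
     (\<forall>(c,d)\<in>M. \<forall>(c',d')\<in>M. (c,d) \<noteq> (c',d') \<longrightarrow> c * d' \<noteq> d * c')"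

text \<open>Labels (i,j,m) of the hyperplanes of the move arrangement; pieces are indexed by the
  finite type 'q (q = CARD('q)). H_ij^m = H_ji^m, so i \<noteq> j is used instead of i < j.\<close>
definition move_labels :: "(int \<times> int) set \<Rightarrow> ('q \<times> 'q \<times> (int \<times> int)) set" where
  "move_labels M = {(i,j,m). i \<noteq> j \<and> m \<in> M}"

definition move_eq :: "(real \<times> real) \<Rightarrow> (real \<times> real) \<Rightarrow> int \<times> int \<Rightarrow> bool" where
  "move_eq zi zj m \<longleftrightarrow>
     (fst zj - fst zi) * of_int (snd m) - (snd zj - snd zi) * of_int (fst m) = 0"

text \<open>The intersection subspace U of the hyperplanes labelled by E (an element of L(A_P)),
  configurations being points of (R^2)^q.\<close>
definition subsp :: "('q::finite \<times> 'q \<times> (int \<times> int)) set \<Rightarrow> ((real \<times> real) ^ 'q) set" where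
  "subsp E = {z. \<forall>(i,j,m)\<in>E. move_eq (z $ i) (z $ j) m}"

definition codim :: "('q::finite \<times> 'q \<times> (int \<times> int)) set \<Rightarrow> nat" where
  "codim E = 2 * CARD('q) - dim (subsp E)"

definition pieces :: "('q \<times> 'q \<times> (int \<times> int)) set \<Rightarrow> 'q set" where
  "pieces E = {k. \<exists>(i,j,m)\<in>E. k = i \<or> k = j}"

text \<open>Essential part: the same move equations in the coordinates of the involved pieces,
  as a subset of (R^2)^kappa (functions on the involved pieces).\<close>
definition ess :: "('q \<times> 'q \<times> (int \<times> int)) set \<Rightarrow> ('q \<Rightarrow> real \<times> real) set" where
  "ess E = {z \<in> pieces E \<rightarrow>\<^sub>E UNIV. \<forall>(i,j,m)\<in>E. move_eq (z i) (z j) m}"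

definition open_cube :: "'q set \<Rightarrow> ('q \<Rightarrow> real \<times> real) set" where
  "open_cube K = {z \<in> K \<rightarrow>\<^sub>E UNIV.
      \<forall>k\<in>K. 0 < fst (z k) \<and> fst (z k) < 1 \<and> 0 < snd (z k) \<and> snd (z k) < 1}"

definition dilate :: "'q set \<Rightarrow> real \<Rightarrow> ('q \<Rightarrow> real \<times> real) \<Rightarrow> ('q \<Rightarrow> real \<times> real)" where
  "dilate K t z = restrict (\<lambda>k. t *\<^sub>R z k) K"

definition alpha :: "('q \<times> 'q \<times> (int \<times> int)) set \<Rightarrow> nat \<Rightarrow> nat" where
  "alpha E n = card {z \<in> dilate (pieces E) (real n + 1) ` (open_cube (pieces E) \<inter> ess E).
       \<forall>k\<in>pieces E. fst (z k) \<in> \<int> \<and> snd (z k) \<in> \<int>}"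

text \<open>A family of constituents c_0..c_{p-1} of degree d with common leading coefficient L
  satisfying the reciprocity/parity relation c_{-i}(-x) = (-1)^d c_i(x).\<close>
definition parity_constituents :: "nat \<Rightarrow> nat \<Rightarrow> real \<Rightarrow> (nat \<Rightarrow> real poly) \<Rightarrow> bool" where
  "parity_constituents p d L c \<longleftrightarrow>
     (\<forall>i<p. degree (c i) = d \<and> lead_coeff (c i) = L) \<and>
     (\<forall>i<p. \<forall>x. poly (c ((p - i) mod p)) (- x) = (-1) ^ d * poly (c i) x)"

end

theory Submission
  imports Defs
begin

text \<open>Two families of constituents of degree \<open>d\<close> with a common leading coefficient, both
  satisfying the reciprocity relation \<open>c\<^sub>-\<^sub>i(-x) = (-1)\<^sup>d c\<^sub>i(x)\<close> and agreeing at
  \<open>n = 1, \<dots>, N\<close>, agree constituent by constituent at every integer \<open>z\<close> with \<open>\<bar>z\<bar> \<le> N\<close> in the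
  residue class \<open>i mod p\<close>: at negative \<open>z\<close> by reciprocity, and at \<open>z = 0\<close> when \<open>d\<close> is odd
  because \<open>c\<^sub>0\<close> is then an odd function. Once \<open>p d \<le> 2N\<close>, every residue class contains at
  least \<open>d\<close> such points, and two polynomials of degree \<open>d\<close> with equal leading coefficients that
  agree at \<open>d\<close> points coincide.\<close>

lemma mod_diff_mod_self:
  fixes i p :: nat
  assumes "i < p"
  shows "(p - (p - i) mod p) mod p = i"
  using assms by (cases "i = 0") auto

lemma parity_constituents_neg:
  assumes "parity_constituents p d L c" and "i < p"
  shows "poly (c i) (- x) = (-1) ^ d * poly (c ((p - i) mod p)) x"
proof -
  have "(p - i) mod p < p"
    using assms(2) by simp
  then have "poly (c ((p - (p - i) mod p) mod p)) (- x)
      = (-1) ^ d * poly (c ((p - i) mod p)) x"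
    using assms(1) unfolding parity_constituents_def by blast
  then show ?thesis
    by (simp only: mod_diff_mod_self [OF assms(2)])
qed

lemma parity_constituents_agree_on_symmetric_window:
  fixes c c' :: "nat \<Rightarrow> real poly" and z :: int
  assumes c: "parity_constituents p d L c" and c': "parity_constituents p d L' c'"
    and agree: "\<And>n. 1 \<le> n \<Longrightarrow> n \<le> N \<Longrightarrow>
      poly (c' (n mod p)) (real n) = poly (c (n mod p)) (real n)"
    and i: "i < p" and z: "\<bar>z\<bar> \<le> int N" "z mod int p = int i" "z = 0 \<longrightarrow> odd d"
  shows "poly (c' i) (of_int z) = poly (c i) (of_int z)"
proof (cases z "0 :: int" rule: linorder_cases)
  case greater
  define n where "n = nat z"
  have "int (n mod p) = int i"
    using greater z(2) by (simp add: n_def of_nat_mod)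
  then have "n mod p = i"
    by simp
  then show ?thesis
    using agree [of n] greater z(1) by (simp add: n_def)
next
  case less
  define n where "n = nat (- z)"
  have "int (n mod p) = (- z) mod int p"
    using less by (simp add: n_def of_nat_mod)
  also have "\<dots> = (- (z mod int p)) mod int p"
    by (simp add: mod_minus_eq)
  also have "\<dots> = (- int i) mod int p"
    using z(2) by simp
  also have "\<dots> = (int p + - int i) mod int p"
    by (rule mod_add_self1 [symmetric])
  also have "\<dots> = int ((p - i) mod p)"
    using i by (simp add: of_nat_mod)
  finally have n_mod: "n mod p = (p - i) mod p"
    by (rule of_nat_eq_iff [THEN iffD1])
  have z_eq: "(of_int z :: real) = - real n"
    using less by (simp add: n_def)
  have "1 \<le> n" "n \<le> N"
    using less z(1) by (simp_all add: n_def)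
  have "poly (c' i) (of_int z) = (-1) ^ d * poly (c' (n mod p)) (real n)"
    using parity_constituents_neg [OF c' i, of "real n"] by (simp only: z_eq n_mod)
  also have "\<dots> = (-1) ^ d * poly (c (n mod p)) (real n)"
    using agree [OF \<open>1 \<le> n\<close> \<open>n \<le> N\<close>] by simp
  also have "\<dots> = poly (c i) (of_int z)"
    using parity_constituents_neg [OF c i, of "real n"] by (simp only: z_eq n_mod)
  finally show ?thesis .
next
  case equal
  with z have "i = 0" "odd d"
    by simp_all
  then have "poly (f 0) 0 = 0" if "parity_constituents p d L'' f" for f L''
    using parity_constituents_neg [OF that i, of 0] by simp
  then show ?thesis
    using c c' equal \<open>i = 0\<close> by simp
qed

lemma card_residue_class_in_interval:
  fixes a i p L :: int
  assumes "0 < p"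
  shows "nat (L div p) \<le> card {x \<in> {a..<a + L}. x mod p = i mod p}"
proof -
  define f where "f t = a + (i - a) mod p + p * t" for t
  have "inj_on f {0..<L div p}"
    using assms by (auto simp: f_def inj_on_def)
  moreover have "f ` {0..<L div p} \<subseteq> {x \<in> {a..<a + L}. x mod p = i mod p}"
  proof
    fix x assume "x \<in> f ` {0..<L div p}"
    then obtain t where t: "0 \<le> t" "t < L div p" "x = f t" by auto
    have "(i - a) mod p < p" "0 \<le> (i - a) mod p" using assms by simp_all
    moreover have "p * (t + 1) \<le> p * (L div p)"
      using t assms by (intro mult_left_mono) auto
    moreover have "p * (L div p) \<le> L"
      using assms by (simp add: minus_mod_eq_mult_div [symmetric])
    moreover have "x mod p = (a + (i - a)) mod p"
      unfolding t(3) f_def by (simp add: mod_add_right_eq)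
    ultimately show "x \<in> {x \<in> {a..<a + L}. x mod p = i mod p}"
      using t by (auto simp: f_def algebra_simps)
  qed
  moreover have "finite {x \<in> {a..<a + L}. x mod p = i mod p}"
    by (rule finite_subset [of _ "{a..<a + L}"]) auto
  ultimately have "card {0..<L div p} \<le> card {x \<in> {a..<a + L}. x mod p = i mod p}"
    by (rule card_inj_on_le)
  then show ?thesis by simp
qed

lemma card_symmetric_multiples_window:
  fixes p N :: int and d :: nat
  assumes p: "0 < p" and bound: "p * int d \<le> 2 * N"
  shows "d \<le> card {z. \<bar>z\<bar> \<le> N \<and> z mod p = 0 \<and> (z = 0 \<longrightarrow> odd d)}"
    (is "_ \<le> card ?R")
proof -
  define k where "k = d div 2"
  have "p * int (2 * k) \<le> p * int d"
    using p by (intro mult_left_mono) (simp_all add: k_def)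
  then have "p * int k \<le> N"
    using bound by simp
  then have k_le: "k \<le> nat (N div p)"
    using zdiv_mono1 [of "p * int k" N p] p by simp
  define Pos where "Pos = {x \<in> {1..<1 + N}. x mod p = 0 mod p}"
  define Neg where "Neg = {x \<in> {-N..<-N + N}. x mod p = 0 mod p}"
  define Zero where "Zero = (if odd d then {0} else {} :: int set)"
  have "k \<le> card Pos" "k \<le> card Neg"
    unfolding Pos_def Neg_def
    using order_trans [OF k_le card_residue_class_in_interval [OF p]] by blast+
  then have "d \<le> card Pos + card Neg + card Zero"
    by (simp add: Zero_def k_def) presburger
  also have "\<dots> = card (Pos \<union> Neg \<union> Zero)"
  proof -
    have "finite Pos" "finite Neg"
      unfolding Pos_def Neg_def by (auto intro: finite_subset [of _ "{-N..N}"])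
    moreover have "Pos \<inter> Neg = {}" "(Pos \<union> Neg) \<inter> Zero = {}"
      by (auto simp: Pos_def Neg_def Zero_def)
    ultimately show ?thesis
      by (simp add: card_Un_disjoint Zero_def)
  qed
  also have "\<dots> \<le> card ?R"
  proof (rule card_mono)
    show "finite ?R"
      by (rule finite_subset [of _ "{-N..N}"]) auto
    have "0 \<le> p * int k"
      using p by simp
    then have "0 \<le> N"
      using \<open>p * int k \<le> N\<close> by linarith
    then show "Pos \<union> Neg \<union> Zero \<subseteq> ?R"
      by (auto simp: Pos_def Neg_def Zero_def)
  qed
  finally show ?thesis .
qed

lemma card_symmetric_residue_window:
  fixes p i N :: int and d :: nat
  assumes p: "0 < p" and i: "0 \<le> i" "i < p" and bound: "p * int d \<le> 2 * N"
  shows "d \<le> card {z. \<bar>z\<bar> \<le> N \<and> z mod p = i \<and> (z = 0 \<longrightarrow> odd d)}"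
    (is "_ \<le> card ?R")
proof (cases "i = 0")
  case True
  then show ?thesis
    using card_symmetric_multiples_window [OF p bound] by simp
next
  case False
  have "int d \<le> 2 * N div p"
    using zdiv_mono1 [OF bound p] p by simp
  also have "nat (2 * N div p) \<le> card {x \<in> {-N + 1..<-N + 1 + 2 * N}. x mod p = i mod p}"
    using p by (rule card_residue_class_in_interval)
  also have "\<dots> \<le> card ?R"
  proof (rule card_mono)
    show "finite ?R"
      by (rule finite_subset [of _ "{-N..N}"]) auto
    show "{x \<in> {-N + 1..<-N + 1 + 2 * N}. x mod p = i mod p} \<subseteq> ?R"
      using False i by auto
  qed
  finally show ?thesis by simp
qed

lemma mult_diff_le_twice_nat_ceiling:
  fixes p k m e :: nat
  shows "p * (2 * k - m) \<le> 2 * (nat \<lceil>real p * (real k - real m / 2)\<rceil> + e)"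
proof (cases "m \<le> 2 * k")
  case True
  then have "real p * (real k - real m / 2) = real (p * (2 * k - m)) / 2"
    by (simp add: field_simps)
  then have "real (p * (2 * k - m)) \<le> real (2 * nat \<lceil>real p * (real k - real m / 2)\<rceil>)"
    by linarith
  then show ?thesis
    unfolding of_nat_le_iff by simp
qed simp

theorem theorem2p1:
  fixes M :: "(int \<times> int) set"
    and E :: "('q::finite \<times> 'q \<times> (int \<times> int)) set"
    and p :: nat and c :: "nat \<Rightarrow> real poly" and L :: real
  assumes "rider_moves M"
    and "E \<subseteq> move_labels M"
    and "p > 0"
    and "\<forall>n. real (alpha E n) = poly (c (n mod p)) (real n)"
    and "parity_constituents p (2 * card (pieces E) - codim E) L c"
  shows "\<forall>c'. parity_constituents p (2 * card (pieces E) - codim E) L c' \<and>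
           (\<forall>n\<in>{1 .. nat \<lceil>real p * (real (card (pieces E)) - real (codim E) / 2)\<rceil>
                        + (if even (codim E) then 1 else 0)}.
               poly (c' (n mod p)) (real n) = real (alpha E n))
           \<longrightarrow> (\<forall>i<p. c' i = c i)"
proof (intro allI impI)
  fix c' i
  define d where "d = 2 * card (pieces E) - codim E"
  define N where "N = nat \<lceil>real p * (real (card (pieces E)) - real (codim E) / 2)\<rceil>
    + (if even (codim E) then 1 else 0)"
  assume "parity_constituents p d L c' \<and>
    (\<forall>n\<in>{1..N}. poly (c' (n mod p)) (real n) = real (alpha E n))" and i: "i < p"
  then have c': "parity_constituents p d L c'"
    and agree: "\<And>n. 1 \<le> n \<Longrightarrow> n \<le> N \<Longrightarrow>
      poly (c' (n mod p)) (real n) = poly (c (n mod p)) (real n)"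
    using assms(4) by auto
  have c: "parity_constituents p d L c"
    using assms(5) by (simp add: d_def)
  have "p * d \<le> 2 * N"
    unfolding d_def N_def by (rule mult_diff_le_twice_nat_ceiling)
  then have "int p * int d \<le> 2 * int N"
    by (metis of_nat_le_iff of_nat_mult of_nat_numeral)
  then obtain R where R: "d \<le> card R"
    "\<And>z. z \<in> R \<Longrightarrow> poly (c' i) (of_int z) = poly (c i) (of_int z)"
    using card_symmetric_residue_window [where p = "int p" and i = "int i" and N = "int N"]
      parity_constituents_agree_on_symmetric_window [OF c c' agree i] assms(3) i
    by fastforce
  have "d \<le> card (real_of_int ` R)"
    using R(1) by (simp add: card_image inj_on_def)
  moreover have "degree (c i) = d" "degree (c' i) = d"
    "lead_coeff (c i) = L" "lead_coeff (c' i) = L"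
    using c c' i unfolding parity_constituents_def by blast+
  ultimately show "c' i = c i"
    using R(2) by (intro poly_eqI_degree_lead_coeff [of _ d _ "real_of_int ` R"]) auto
qed

end
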